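(* Consider iteration $k\ge1$ of the BPIREe algorithm, with the previous iterates fixed and $s_i=b_k$ the selected block, under Assumption 1 of the context and with $\alpha_k=\frac1{2L_k}$. Suppose $$x^{k-1}_{s_i}\notin\arg\min_{x_{s_i}}\Big\{\langle\nabla_{s_i}f(x^{k-1}),x_{s_i}-x^{k-1}_{s_i}\rangle+\frac1{2\alpha_k}\|x_{s_i}-x^{k-1}_{s_i}\|^2+\sum_{j\in s_i}w^{k-1}_jg(x_j)\Big\}.$$ Then there exists $\bar\beta_k>0$ such that $F(x^k)\le F(x^{k-1})$ for any $\beta_k\in[0,\bar\beta_k]$, where $x^k$ is the iterate produced at iteration $k$ with extrapolation parameter $\beta_k$.
   Context: Problem. Let $\{s_1,\dots,s_m\}$ be a partition of $\{1,\dots,n\}$ into disjoint blocks; $x_{s_i}$ is the subvector of $x\in\mathbb{R}^n$ indexed by $s_i$, $\nabla_{s_i}f$ the partial gradient with respect to $x_{s_i}$, and $(x_{\neq s_i},y_{s_i})$ is $x$ with block $s_i$ replaced by $y_{s_i}$. For $\lambda>0$ consider minimizing $F(x)=f(x)+\lambda\sum_{i=1}^m\sum_{j\in s_i}h(g(x_j))$ over $x\in\mathbb{R}^n$. Assumption 1. (i) $f:\mathbb{R}^n\to\mathbb{R}$ is continuously differentiable and, for each block, its partial gradient is Lipschitz in that block when the other blocks are fixed, with Lipschitz constants lying in $[\ell,L]$ for some $0<\ell\le L<\infty$. (ii) $g:\mathbb{R}\to\mathbb{R}$ is nonnegative, closed and convex. (iii) $h:\mathrm{Im}(g)\to\mathbb{R}_+$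 is concave and differentiable, $h'(t)>0$ on $\mathrm{Im}(g)$, and $|h'(s)-h'(t)|\le L_h|s-t|$ for all $s,t\in\mathrm{Im}(g)$. (iv) $F$ is coercive: $F(x)\to+\infty$ as $\|x\|\to+\infty$. BPIREe algorithm. Start from $x^{-1}=x^0$. At iteration $k=1,2,\dots$ choose a block $b_k\in\{s_1,\dots,s_m\}$ (deterministically or randomly). Set $x^k_{s_i}=x^{k-1}_{s_i}$ if $s_i\ne b_k$, and for $s_i=b_k$ $$x^k_{s_i}=\arg\min_{x_{s_i}}\Big\{\langle\nabla_{s_i}f(x^{k-1}_{\neq s_i},\hat x^k_{s_i}),x_{s_i}\rangle+\tfrac1{2\alpha_k}\|x_{s_i}-\hat x^k_{s_i}\|^2+\sum_{j\in s_i}w^{k-1}_jg(x_j)\Big\},$$ where $w^{k-1}_j=\lambda h'(g(x^{k-1}_j))$, $\hat x^k_{s_i}=x^{k-1}_{s_i}+\beta_k(x^{k-1}_{s_i}-x^{\rm prev}_{s_i})$, $0\le\beta_k\le1$, and $x^{\rm prev}_{s_i}$ is the value of block $s_i$ just before its most recent update prior to iteration $k$ (equal to $x^0_{s_i}$ if block $s_i$ has not been updated before). $L_k\in[\ell,L]$ denotes a Lipschitz constant of $y\mapsto\nabla_{b_k}f(x^{k-1}_{\neq b_k},y)$. *)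

theory Defs
  imports "HOL-Analysis.Analysis" "HOL-Library.Disjoint_Sets"
begin

text \<open>
  A subvector indexed by a block \<open>s\<close> is represented by the full vector that agrees with it on
  \<open>s\<close> and vanishes outside; \<open>block_space s\<close> is thus a copy of the Euclidean space of dimension
  \<open>card s\<close>, with the same inner product and norm.
\<close>

definition block_space :: "'n::finite set \<Rightarrow> (real ^ 'n) set" where
  "block_space s = {y. \<forall>j. j \<notin> s \<longrightarrow> y $ j = 0}"

definition block :: "'n::finite set \<Rightarrow> real ^ 'n \<Rightarrow> real ^ 'n" where
  "block s x = (\<chi> j. if j \<in> s then x $ j else 0)"

definition block_replace :: "'n::finite set \<Rightarrow> real ^ 'n \<Rightarrow> real ^ 'n \<Rightarrow> real ^ 'n" where
  "block_replace s x y = (\<chi> j. if j \<in> s then y $ j else x $ j)"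

definition gradient :: "(real ^ 'n::finite \<Rightarrow> real) \<Rightarrow> real ^ 'n \<Rightarrow> real ^ 'n" where
  "gradient f x = (\<chi> j. frechet_derivative f (at x) (axis j 1))"

definition block_grad :: "(real ^ 'n::finite \<Rightarrow> real) \<Rightarrow> 'n set \<Rightarrow> real ^ 'n \<Rightarrow> real ^ 'n" where
  "block_grad f s x = block s (gradient f x)"

definition objective ::
  "(real ^ 'n::finite \<Rightarrow> real) \<Rightarrow> (real \<Rightarrow> real) \<Rightarrow> (real \<Rightarrow> real) \<Rightarrow> real \<Rightarrow> 'n set set
    \<Rightarrow> real ^ 'n \<Rightarrow> real" where
  "objective f g h lam P x = f x + lam * (\<Sum>s\<in>P. \<Sum>j\<in>s. h (g (x $ j)))"

text \<open>
  The function \<open>h\<close> matters only on \<open>range g\<close>, so its derivative \<open>h'\<close> is taken within that set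
  (one-sided at an endpoint).  It is an explicit parameter because it is not determined by \<open>h\<close> in
  the degenerate case of a constant \<open>g\<close>.  A closed function is one with closed epigraph.
\<close>

definition bpiree_assms ::
  "(real ^ 'n::finite \<Rightarrow> real) \<Rightarrow> (real \<Rightarrow> real) \<Rightarrow> (real \<Rightarrow> real) \<Rightarrow> (real \<Rightarrow> real) \<Rightarrow> real
    \<Rightarrow> 'n set set \<Rightarrow> real \<Rightarrow> real \<Rightarrow> real \<Rightarrow> bool" where
  "bpiree_assms f g h h' lam P l L Lh \<longleftrightarrow>
     (\<forall>x. f differentiable (at x)) \<and> continuous_on UNIV (gradient f) \<and>
     0 < l \<and> l \<le> L \<and>
     (\<forall>s\<in>P. \<forall>x. \<exists>K\<in>{l..L}. K-lipschitz_on (block_space s) (\<lambda>y. block_grad f s (block_replace s x y))) \<and>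
     (\<forall>t. 0 \<le> g t) \<and> closed (epigraph UNIV g) \<and> convex_on UNIV g \<and>
     (\<forall>t\<in>range g. 0 \<le> h t) \<and> concave_on (range g) h \<and>
     (\<forall>t\<in>range g. (h has_real_derivative h' t) (at t within range g)) \<and>
     (\<forall>t\<in>range g. 0 < h' t) \<and>
     (\<forall>s\<in>range g. \<forall>t\<in>range g. \<bar>h' s - h' t\<bar> \<le> Lh * \<bar>s - t\<bar>) \<and>
     filterlim (objective f g h lam P) at_top at_infinity"

definition weight :: "(real \<Rightarrow> real) \<Rightarrow> (real \<Rightarrow> real) \<Rightarrow> real \<Rightarrow> real ^ 'n::finite \<Rightarrow> 'n \<Rightarrow> real" where
  "weight g h' lam x j = lam * h' (g (x $ j))"

text \<open>
  \<open>last_value x b k s\<close> is the iterate just before the most recent update of block \<open>s\<close> prior to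
  iteration \<open>k\<close>; only its \<open>s\<close>-block is used.
\<close>

definition last_value ::
  "(nat \<Rightarrow> real ^ 'n::finite) \<Rightarrow> (nat \<Rightarrow> 'n set) \<Rightarrow> nat \<Rightarrow> 'n set \<Rightarrow> real ^ 'n" where
  "last_value x b k s =
     (if \<exists>j\<in>{1..<k}. b j = s then x (Max {j\<in>{1..<k}. b j = s} - 1) else x 0)"

definition extrapolated ::
  "(nat \<Rightarrow> real ^ 'n::finite) \<Rightarrow> (nat \<Rightarrow> 'n set) \<Rightarrow> nat \<Rightarrow> real \<Rightarrow> real ^ 'n" where
  "extrapolated x b k \<beta> =
     block (b k) (x (k - 1)) +
     \<beta> *\<^sub>R (block (b k) (x (k - 1)) - block (b k) (last_value x b k (b k)))"

definition subproblem ::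
  "(real ^ 'n::finite \<Rightarrow> real) \<Rightarrow> (real \<Rightarrow> real) \<Rightarrow> (real \<Rightarrow> real) \<Rightarrow> real \<Rightarrow> 'n set
    \<Rightarrow> real ^ 'n \<Rightarrow> real ^ 'n \<Rightarrow> real \<Rightarrow> real ^ 'n \<Rightarrow> real" where
  "subproblem f g h' lam s x xhat \<alpha> y =
     block_grad f s (block_replace s x xhat) \<bullet> y
     + 1 / (2 * \<alpha>) * (norm (y - xhat))\<^sup>2
     + (\<Sum>j\<in>s. weight g h' lam x j * g (y $ j))"

text \<open>
  Iteration \<open>k\<close> of BPIREe, depending on the iterates \<open>x 0, \<dots>, x (k - 1)\<close> only.  For \<open>\<alpha> > 0\<close> the
  subproblem is continuous, strongly convex and coercive on the block space, so \<open>arg_min\<close> picks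
  its unique minimizer.
\<close>

definition bpiree_iterate ::
  "(real ^ 'n::finite \<Rightarrow> real) \<Rightarrow> (real \<Rightarrow> real) \<Rightarrow> (real \<Rightarrow> real) \<Rightarrow> real
    \<Rightarrow> (nat \<Rightarrow> real ^ 'n) \<Rightarrow> (nat \<Rightarrow> 'n set) \<Rightarrow> nat \<Rightarrow> real \<Rightarrow> real \<Rightarrow> real ^ 'n" where
  "bpiree_iterate f g h' lam x b k \<alpha> \<beta> =
     block_replace (b k) (x (k - 1))
       (arg_min (subproblem f g h' lam (b k) (x (k - 1)) (extrapolated x b k \<beta>) \<alpha>)
                (\<lambda>y. y \<in> block_space (b k)))"

end

theory Submission
  imports Defs
begin

text \<open>
  Write \<open>s\<close> for the selected block, \<open>z\<close> for the \<open>s\<close>-block of the previous iterate, \<open>G\<close> for the partial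
  gradient as a function of that block and \<open>\<phi> y = (\<Sum>j\<in>s. w\<^sub>j g (y\<^sub>j))\<close> for the reweighted regularizer.

  The objective is majorized along the block: the Lipschitz bound on \<open>G\<close> majorizes \<open>f\<close> by a quadratic
  of curvature \<open>L\<^sub>k\<close> (\<open>descent_along_segment\<close>), and concavity of \<open>h\<close> majorizes \<open>h \<circ> g\<close> by its
  tangent in \<open>g\<close> (\<open>concave_on_imp_below_tangent\<close>), whose slopes, times \<open>lam\<close>, are the weights.  Replacing
  \<open>z\<close> by \<open>y\<close> therefore changes \<open>F\<close> by at most
  \<open>G z \<bullet> (y - z) + L\<^sub>k/2 \<parallel>y - z\<parallel>\<^sup>2 + \<phi> y - \<phi> z\<close>  (\<open>objective_block_majorant\<close>).

  The choice \<open>\<alpha>\<^sub>k = 1/(2 L\<^sub>k)\<close> makes the quadratic coefficient in the subproblem \<open>L\<^sub>k\<close>, twice the one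
  needed for majorization.  The spare \<open>L\<^sub>k/2 \<parallel>y - z\<parallel>\<^sup>2\<close> absorbs the error that is due to
  extrapolation: for extrapolation parameter \<open>t\<close>, the majorant at the iterate exceeds the value of
  any fixed competitor in the subproblem without extrapolation by at most \<open>O(t)\<close>
  (\<open>extrapolated_minimizer_bound\<close>).  Since \<open>z\<close> does not solve that subproblem, some competitor
  beats it by a fixed \<open>\<delta> > 0\<close>, and for small \<open>t\<close> the error is at most \<open>\<delta>\<close>.  The error
  bound depends on the competitor but not on the iterate, so how the iterate varies with \<open>t\<close> does
  not matter.
\<close>

section \<open>Majorization of smooth and of concave functions\<close>

lemma frechet_derivative_eq_gradient_inner:
  fixes f :: "real ^ 'n::finite \<Rightarrow> real"
  assumes "f differentiable (at x)"
  shows "frechet_derivative f (at x) v = gradient f x \<bullet> v"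
proof -
  have lin: "linear (frechet_derivative f (at x))"
    using assms by (rule linear_frechet_derivative)
  have "frechet_derivative f (at x) v
      = frechet_derivative f (at x) (\<Sum>j\<in>UNIV. (v $ j) *\<^sub>R axis j 1)"
    using basis_expansion[of v] by (simp add: scalar_mult_eq_scaleR)
  also have "\<dots> = (\<Sum>j\<in>UNIV. (v $ j) * frechet_derivative f (at x) (axis j 1))"
    by (simp add: linear_sum[OF lin] linear_scale[OF lin])
  also have "\<dots> = gradient f x \<bullet> v"
    by (simp add: gradient_def inner_vec_def mult.commute)
  finally show ?thesis .
qed

text \<open>
  The descent lemma on a single segment.  Only the growth of the directional derivative along the
  segment enters, so a Lipschitz bound on one block of the gradient suffices.  With
  \<open>u *\<^sub>R v\<close> in place of \<open>v\<close>, the difference of the two sides has nonpositive derivative in \<open>u\<close>.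
\<close>

lemma descent_along_segment:
  fixes f :: "real ^ 'n::finite \<Rightarrow> real"
  assumes diff: "\<And>x. f differentiable (at x)"
    and growth: "\<And>u. 0 \<le> u \<Longrightarrow> u \<le> 1 \<Longrightarrow>
      (gradient f (a + u *\<^sub>R v) - gradient f a) \<bullet> v \<le> K * u * (norm v)\<^sup>2"
  shows "f (a + v) \<le> f a + gradient f a \<bullet> v + K / 2 * (norm v)\<^sup>2"
proof -
  define q where
    "q u = f (a + u *\<^sub>R v) - u * (gradient f a \<bullet> v) - K / 2 * u\<^sup>2 * (norm v)\<^sup>2" for u
  have seg: "((\<lambda>u. f (a + u *\<^sub>R v)) has_real_derivative gradient f (a + u *\<^sub>R v) \<bullet> v) (at u)" for u
  proof -
    have df: "(f has_derivative (\<lambda>w. gradient f (a + u *\<^sub>R v) \<bullet> w)) (at (a + u *\<^sub>R v))"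
      using diff[of "a + u *\<^sub>R v"]
      unfolding frechet_derivative_works frechet_derivative_eq_gradient_inner[OF diff, abs_def] .
    have "((\<lambda>u. f (a + u *\<^sub>R v)) has_derivative (\<lambda>w. gradient f (a + u *\<^sub>R v) \<bullet> (w *\<^sub>R v))) (at u)"
      by (rule has_derivative_compose[where g = f and f = "\<lambda>u. a + u *\<^sub>R v", OF _ df])
        (auto intro!: derivative_eq_intros)
    then show ?thesis
      by (simp add: has_field_derivative_def mult_commute_abs)
  qed
  have dq: "(q has_real_derivative
      (gradient f (a + u *\<^sub>R v) - gradient f a) \<bullet> v - K * u * (norm v)\<^sup>2) (at u)" for u
    unfolding q_def
    by (rule derivative_eq_intros seg refl)+ (simp add: inner_diff_left)
  have "q 1 \<le> q 0"
  proof (rule DERIV_nonpos_imp_nonincreasing[where f = q])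
    fix u :: real assume "0 \<le> u" "u \<le> 1"
    then show "\<exists>y. (q has_real_derivative y) (at u) \<and> y \<le> 0"
      using dq[of u] growth[of u] by (intro exI[of _ "_ - _"]) auto
  qed simp
  then show ?thesis by (simp add: q_def)
qed

text \<open>
  The point \<open>c\<close> may be an endpoint of \<open>A\<close>, where the derivative is one-sided: the segment from
  \<open>c\<close> to \<open>t\<close> lies in \<open>A\<close>, and the increment \<open>h t - h c\<close> is at most each difference quotient along
  it, hence at most their limit at \<open>c\<close>.
\<close>

lemma concave_on_imp_below_tangent:
  fixes h :: "real \<Rightarrow> real"
  assumes conc: "concave_on A h"
    and c: "c \<in> A" and t: "t \<in> A"
    and deriv: "(h has_real_derivative D) (at c within A)"
  shows "h t \<le> h c + D * (t - c)"
proof -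
  define p where "p u = c + u * (t - c)" for u
  have p_alt: "p u = (1 - u) *\<^sub>R c + u *\<^sub>R t" for u
    by (simp add: p_def algebra_simps)
  have pA: "p ` {0..1} \<subseteq> A"
    using conc c t convexD_alt[of A c t] by (auto simp: concave_on_def p_alt convex_on_imp_convex)
  have dp: "(p has_real_derivative t - c) (at 0 within {0..1})"
    unfolding p_def by (auto intro!: derivative_eq_intros)
  have "(h has_real_derivative D) (at (p 0) within p ` {0..1})"
    using DERIV_subset[OF deriv pA] by (simp add: p_def)
  from DERIV_image_chain[OF this dp]
  have "((\<lambda>u. (h (p u) - h c) / u) \<longlongrightarrow> D * (t - c)) (at 0 within {0..1})"
    by (simp add: has_field_derivative_iff o_def p_def)
  moreover have "eventually (\<lambda>u. h t - h c \<le> (h (p u) - h c) / u) (at 0 within {0..1::real})"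
  proof (rule eventually_at_topological[THEN iffD2], intro exI[of _ UNIV] conjI ballI impI)
    fix u :: real assume u: "u \<noteq> 0" "u \<in> {0..1}"
    have "(1 - u) * h c + u * h t \<le> h (p u)"
      using concave_onD[OF conc, of u c t] u c t by (simp add: p_alt)
    then show "h t - h c \<le> (h (p u) - h c) / u"
      using u by (simp add: field_simps)
  qed auto
  moreover have "at 0 within {0..1::real} \<noteq> bot"
    by (simp add: trivial_limit_within islimpt_Icc)
  ultimately have "h t - h c \<le> D * (t - c)"
    by (intro tendsto_lowerbound)
  then show ?thesis by simp
qed

section \<open>The proximal subproblem\<close>

text \<open>
  The minimizer exists because the quadratic term outgrows the linear one and \<open>\<phi>\<close> is nonnegative,
  so that sublevel sets are compact.
\<close>

lemma prox_subproblem_has_minimizer: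
  fixes c p :: "'a::euclidean_space" and \<phi> :: "'a \<Rightarrow> real"
  assumes S: "closed S" "S \<noteq> {}" and a: "0 < a"
    and cont: "continuous_on UNIV \<phi>" and nonneg: "\<And>y. 0 \<le> \<phi> y"
  shows "\<exists>y. is_arg_min (\<lambda>y. c \<bullet> y + a * (norm (y - p))\<^sup>2 + \<phi> y) (\<lambda>y. y \<in> S) y"
proof -
  define Q where "Q y = c \<bullet> y + a * (norm (y - p))\<^sup>2 + \<phi> y" for y
  have contQ: "continuous_on T Q" for T
    unfolding Q_def by (intro continuous_intros continuous_on_subset[OF cont]) auto
  obtain y0 where y0: "y0 \<in> S" using S by blast
  define M where "M = \<bar>Q y0 - c \<bullet> p\<bar>"
  define T where "T = S \<inter> {y. Q y \<le> Q y0}"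
  \<comment> \<open>At distance more than \<open>R\<close> from \<open>p\<close> the quadratic term exceeds the linear one by more than \<open>M\<close>.\<close>
  define R where "R = (norm c + M) / a + 1"
  have "T \<subseteq> cball p R"
  proof
    fix y assume "y \<in> T"
    then have le: "c \<bullet> (y - p) + a * (norm (y - p))\<^sup>2 \<le> M"
      using nonneg[of y] by (auto simp: T_def Q_def M_def inner_diff_right)
    have "norm (y - p) \<le> R"
    proof (rule ccontr)
      assume "\<not> norm (y - p) \<le> R"
      then have r: "R < norm (y - p)" by simp
      have R1: "1 \<le> R" using a by (simp add: R_def M_def)
      have "a * R = norm c + M + a" using a by (simp add: R_def field_simps)
      then have "norm c + M < a * norm (y - p)"
        using r a mult_strict_left_mono[OF r a] by linarith
      then have "1 * M < norm (y - p) * (a * norm (y - p) - norm c)"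
        using r R1 by (intro mult_le_less_imp_less) (auto simp: M_def)
      moreover have "- (norm c * norm (y - p)) \<le> c \<bullet> (y - p)"
        using Cauchy_Schwarz_ineq2[of c "y - p"] by linarith
      ultimately show False
        using le by (simp add: algebra_simps power2_eq_square)
    qed
    then show "y \<in> cball p R" by (simp add: dist_norm norm_minus_commute)
  qed
  moreover have "closed T"
    unfolding T_def by (intro closed_Int S closed_Collect_le contQ continuous_intros)
  ultimately have "compact T"
    using bounded_subset[OF bounded_cball] compact_eq_bounded_closed by blast
  moreover have "T \<noteq> {}" using y0 by (auto simp: T_def)
  ultimately have "\<exists>y\<in>T. \<forall>e\<in>T. Q y \<le> Q e"
    using contQ by (rule continuous_attains_inf)
  then obtain y where y: "y \<in> T" "\<And>e. e \<in> T \<Longrightarrow> Q y \<le> Q e"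
    by auto
  have "Q y \<le> Q e" if "e \<in> S" for e
    using y that by (cases "Q e \<le> Q y0") (auto simp: T_def)
  then have "is_arg_min Q (\<lambda>y. y \<in> S) y"
    using y by (force simp: is_arg_min_linorder T_def)
  then show ?thesis by (auto simp: Q_def[abs_def])
qed

text \<open>
  Moving the prox centre from \<open>z\<close> to \<open>p\<close> perturbs the subproblem, at distance \<open>\<rho>\<close> from \<open>z\<close>, by at
  most \<open>3 K \<parallel>p - z\<parallel> \<rho>\<close>, apart from an additive constant: one part comes from the change of the
  gradient and two parts come from the change of the quadratic.  At the minimizer \<open>y\<close> this is
  absorbed by half of the quadratic term, as \<open>3 \<tau> \<rho> - \<rho>\<^sup>2/2 \<le> 9/2 \<tau>\<^sup>2\<close>.
\<close>

lemma extrapolated_minimizer_bound: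
  fixes \<phi> :: "'a::real_inner \<Rightarrow> real"
  assumes K: "0 \<le> K"
    and lip: "norm (c' - c) \<le> K * norm (p - z)"
    and min: "c' \<bullet> y + K * (norm (y - p))\<^sup>2 + \<phi> y \<le> c' \<bullet> e + K * (norm (e - p))\<^sup>2 + \<phi> e"
  shows "c \<bullet> (y - z) + K / 2 * (norm (y - z))\<^sup>2 + \<phi> y
       \<le> c \<bullet> (e - z) + K * (norm (e - z))\<^sup>2 + \<phi> e
         + 3 * K * norm (p - z) * norm (e - z) + 9 / 2 * K * (norm (p - z))\<^sup>2"
proof -
  let ?\<tau> = "norm (p - z)"
  have perturb: "\<bar>(c' - c) \<bullet> v - 2 * K * ((p - z) \<bullet> v)\<bar> \<le> 3 * K * ?\<tau> * norm v" for v
  proof -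
    have "\<bar>(c' - c) \<bullet> v\<bar> \<le> K * ?\<tau> * norm v"
      using Cauchy_Schwarz_ineq2[of "c' - c" v] mult_right_mono[OF lip, of "norm v"] by simp
    moreover have "\<bar>2 * K * ((p - z) \<bullet> v)\<bar> \<le> 2 * K * (?\<tau> * norm v)"
      using Cauchy_Schwarz_ineq2[of "p - z" v] K by (simp add: abs_mult mult_left_mono)
    ultimately show ?thesis by linarith
  qed
  have expand: "c' \<bullet> v + K * (norm (v - p))\<^sup>2
      = c \<bullet> (v - z) + K * (norm (v - z))\<^sup>2
        + ((c' - c) \<bullet> (v - z) - 2 * K * ((p - z) \<bullet> (v - z))) + (c' \<bullet> z + K * ?\<tau>\<^sup>2)" for v
    by (simp add: power2_norm_eq_inner inner_diff_left inner_diff_right inner_commute algebra_simps)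
  have "0 \<le> K / 2 * (norm (y - z) - 3 * ?\<tau>)\<^sup>2"
    using K by simp
  then have "3 * K * ?\<tau> * norm (y - z) \<le> K / 2 * (norm (y - z))\<^sup>2 + 9 / 2 * K * ?\<tau>\<^sup>2"
    by (simp add: power2_eq_square algebra_simps)
  then show ?thesis
    using min perturb[of "y - z"] perturb[of "e - z"] unfolding expand by linarith
qed

section \<open>Moving a single block\<close>

lemma block_in_block_space [simp]: "block s x \<in> block_space s"
  by (simp add: block_def block_space_def)

lemma subspace_block_space: "subspace (block_space s)"
  by (auto simp: subspace_def block_space_def)

lemma block_replace_eq_add:
  "y \<in> block_space s \<Longrightarrow> block_replace s x y = x + (y - block s x)"
  by (auto simp: block_replace_def block_def block_space_def vec_eq_iff)

lemma block_inner:
  assumes "v \<in> block_space s" shows "block s c \<bullet> v = c \<bullet> v"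
  unfolding inner_vec_def using assms
  by (intro sum.cong) (auto simp: block_def block_space_def)

lemma sum_partition_UNIV:
  fixes q :: "'n::finite \<Rightarrow> 'a::comm_monoid_add"
  assumes "partition_on UNIV P"
  shows "(\<Sum>s\<in>P. \<Sum>j\<in>s. q j) = sum q UNIV"
proof -
  have "pairwise disjnt P"
    using assms by (simp add: partition_on_def disjoint_def pairwise_def disjnt_def)
  then have "sum q (\<Union>P) = (\<Sum>s\<in>P. sum q s)"
    by (subst sum.Union_disjoint) (auto simp: pairwise_def disjnt_def)
  then show ?thesis
    using assms by (simp add: partition_on_def)
qed

text \<open>
  Along block directions the derivative of \<open>f\<close> is the inner product with the partial gradient, and
  the regularizer changes only in the coordinates of \<open>s\<close>.  There the tangent of \<open>h\<close> at \<open>g (x\<^sub>j)\<close>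
  has slope \<open>h' (g (x\<^sub>j))\<close>, which times \<open>lam\<close> is the weight.
\<close>

lemma objective_block_majorant:
  fixes f :: "real ^ 'n::finite \<Rightarrow> real"
  assumes part: "partition_on UNIV P" and lam: "0 \<le> lam"
    and diff: "\<And>x. f differentiable (at x)"
    and lip: "K-lipschitz_on (block_space s) (\<lambda>y. block_grad f s (block_replace s x y))"
    and conc: "concave_on (range g) h"
    and deriv: "\<And>t. t \<in> range g \<Longrightarrow> (h has_real_derivative h' t) (at t within range g)"
    and y: "y \<in> block_space s"
  shows "objective f g h lam P (block_replace s x y)
       \<le> objective f g h lam P x + block_grad f s x \<bullet> (y - block s x)
         + K / 2 * (norm (y - block s x))\<^sup>2
         + (\<Sum>j\<in>s. weight g h' lam x j * g (y $ j))
         - (\<Sum>j\<in>s. weight g h' lam x j * g (block s x $ j))"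
proof -
  define z where "z = block s x"
  define v where "v = y - z"
  have v: "v \<in> block_space s"
    unfolding v_def z_def using y by (intro subspace_diff[OF subspace_block_space]) auto
  have "f (x + v) \<le> f x + gradient f x \<bullet> v + K / 2 * (norm v)\<^sup>2"
  proof (rule descent_along_segment[OF diff])
    fix u :: real assume u: "0 \<le> u" "u \<le> 1"
    define G where "G y = block_grad f s (block_replace s x y)" for y
    have mem: "z + u *\<^sub>R v \<in> block_space s"
      unfolding z_def using v
      by (intro subspace_add[OF subspace_block_space] subspace_scale[OF subspace_block_space]) auto
    have G: "G (z + u *\<^sub>R v) = block s (gradient f (x + u *\<^sub>R v))" "G z = block s (gradient f x)"
      using block_replace_eq_add[OF mem, of x] block_replace_eq_add[of z s x]
      by (simp_all add: G_def block_grad_def z_def)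
    have "(gradient f (x + u *\<^sub>R v) - gradient f x) \<bullet> v = (G (z + u *\<^sub>R v) - G z) \<bullet> v"
      by (simp add: G inner_diff_left block_inner[OF v])
    also have "\<dots> \<le> norm (G (z + u *\<^sub>R v) - G z) * norm v"
      by (rule norm_cauchy_schwarz)
    also have "\<dots> \<le> (K * norm (u *\<^sub>R v)) * norm v"
      using lipschitz_onD[OF lip mem, of z]
      by (intro mult_right_mono) (auto simp: G_def dist_norm z_def)
    also have "\<dots> = K * u * (norm v)\<^sup>2"
      using u by (simp add: power2_eq_square)
    finally show "(gradient f (x + u *\<^sub>R v) - gradient f x) \<bullet> v \<le> K * u * (norm v)\<^sup>2" .
  qed
  then have f_le: "f (block_replace s x y)
      \<le> f x + block_grad f s x \<bullet> v + K / 2 * (norm v)\<^sup>2"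
    using block_replace_eq_add[OF y, of x] block_inner[OF v, of "gradient f x"]
    by (simp add: block_grad_def v_def z_def)
  have "lam * h (g (block_replace s x y $ j)) - lam * h (g (x $ j))
      \<le> (if j \<in> s then weight g h' lam x j * g (y $ j) - weight g h' lam x j * g (z $ j) else 0)" for j
  proof (cases "j \<in> s")
    case True
    have "h (g (y $ j)) \<le> h (g (x $ j)) + h' (g (x $ j)) * (g (y $ j) - g (x $ j))"
      using conc deriv by (intro concave_on_imp_below_tangent[where A = "range g"]) auto
    from mult_left_mono[OF this lam] True show ?thesis
      by (simp add: block_replace_def z_def block_def weight_def algebra_simps)
  qed (simp add: block_replace_def)
  then have "(\<Sum>j\<in>UNIV. lam * h (g (block_replace s x y $ j)) - lam * h (g (x $ j)))
      \<le> (\<Sum>j\<in>UNIV. if j \<in> s then weight g h' lam x j * g (y $ j) - weight g h' lam x j * g (z $ j) else 0)"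
    by (rule sum_mono)
  then have "lam * (\<Sum>j\<in>UNIV. h (g (block_replace s x y $ j))) - lam * (\<Sum>j\<in>UNIV. h (g (x $ j)))
      \<le> (\<Sum>j\<in>s. weight g h' lam x j * g (y $ j)) - (\<Sum>j\<in>s. weight g h' lam x j * g (z $ j))"
    by (simp add: sum_subtractf sum_distrib_left sum.If_cases)
  with f_le show ?thesis
    by (simp add: objective_def sum_partition_UNIV[OF part] v_def z_def)
qed

section \<open>Monotonicity for small extrapolation parameters\<close>


theorem lemma3p3:
  fixes f :: "real ^ 'n::finite \<Rightarrow> real"
    and g h h' :: "real \<Rightarrow> real"
    and lam l L Lh Lk :: real
    and P :: "'n set set"
    and x :: "nat \<Rightarrow> real ^ 'n"
    and b :: "nat \<Rightarrow> 'n set"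
    and \<alpha> \<beta> :: "nat \<Rightarrow> real"
    and k :: nat
  assumes "partition_on UNIV P" and "0 < lam"
    and "bpiree_assms f g h h' lam P l L Lh"
    and "1 \<le> k"
    and "\<And>j. j \<in> {1..k} \<Longrightarrow> b j \<in> P"
    and "\<And>j. j \<in> {1..<k} \<Longrightarrow>
           0 < \<alpha> j \<and> 0 \<le> \<beta> j \<and> \<beta> j \<le> 1 \<and>
           x j = bpiree_iterate f g h' lam x b j (\<alpha> j) (\<beta> j)"
    and "Lk \<in> {l..L}"
    and "Lk-lipschitz_on (block_space (b k)) (\<lambda>y. block_grad f (b k) (block_replace (b k) (x (k - 1)) y))"
    and "\<alpha> k = 1 / (2 * Lk)"
    and "\<not> is_arg_min
           (\<lambda>y. block_grad f (b k) (x (k - 1)) \<bullet> (y - block (b k) (x (k - 1)))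
                 + 1 / (2 * \<alpha> k) * (norm (y - block (b k) (x (k - 1))))\<^sup>2
                 + (\<Sum>j\<in>b k. weight g h' lam (x (k - 1)) j * g (y $ j)))
           (\<lambda>y. y \<in> block_space (b k))
           (block (b k) (x (k - 1)))"
  shows "\<exists>\<beta>bar>0. \<forall>t\<in>{0..\<beta>bar}.
           objective f g h lam P (bpiree_iterate f g h' lam x b k (\<alpha> k) t)
             \<le> objective f g h lam P (x (k - 1))"
proof -
  let ?s = "b k" and ?X = "x (k - 1)"
  define z where "z = block ?s ?X"
  define d where "d = z - block ?s (last_value x b k ?s)"
  define G where "G y = block_grad f ?s (block_replace ?s ?X y)" for y
  define \<phi> where "\<phi> y = (\<Sum>j\<in>?s. weight g h' lam ?X j * g (y $ j))" for y :: "real ^ 'n"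
  note lip = assms(8)
  have diff: "f differentiable (at y)" for y
    using assms(3) by (simp add: bpiree_assms_def)
  have conc: "concave_on (range g) h"
    and deriv: "\<And>t. t \<in> range g \<Longrightarrow> (h has_real_derivative h' t) (at t within range g)"
    and h'_pos: "\<And>t. t \<in> range g \<Longrightarrow> 0 < h' t"
    and g_nonneg: "\<And>t. 0 \<le> g t" and g_convex: "convex_on UNIV g"
    using assms(3) by (auto simp: bpiree_assms_def)
  have Lk: "0 < Lk"
    using assms(3,7) by (auto simp: bpiree_assms_def)
  have coeff: "1 / (2 * \<alpha> k) = Lk"
    using Lk assms(9) by simp
  have zG: "G z = block_grad f ?s ?X"
    using block_replace_eq_add[of z ?s ?X] by (simp add: G_def z_def)
  have cont_\<phi>: "continuous_on UNIV \<phi>"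
    unfolding \<phi>_def
    by (intro continuous_intros continuous_on_compose2[OF convex_on_continuous[OF open_UNIV g_convex]]) auto
  have \<phi>_nonneg: "0 \<le> \<phi> y" for y
    unfolding \<phi>_def weight_def using assms(2) h'_pos g_nonneg
    by (intro sum_nonneg mult_nonneg_nonneg) (auto intro: less_imp_le)

  \<comment> \<open>the competitor, which exists because \<open>z\<close> is not a minimizer\<close>
  obtain e where e: "e \<in> block_space ?s"
    and e_less: "G z \<bullet> (e - z) + Lk * (norm (e - z))\<^sup>2 + \<phi> e < \<phi> z"
    using assms(10) zG unfolding coeff \<phi>_def z_def by (auto simp: is_arg_min_linorder not_le)
  define \<delta> where "\<delta> = \<phi> z - (G z \<bullet> (e - z) + Lk * (norm (e - z))\<^sup>2 + \<phi> e)"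
  define C where "C = 3 * Lk * norm d * norm (e - z) + 9 / 2 * Lk * (norm d)\<^sup>2"
  have \<delta>: "0 < \<delta>" using e_less by (simp add: \<delta>_def)
  have C: "0 \<le> C" using Lk by (simp add: C_def)
  have decrease: "objective f g h lam P (bpiree_iterate f g h' lam x b k (\<alpha> k) t)
      \<le> objective f g h lam P ?X"
    if t: "0 \<le> t" "t \<le> 1" "t * C \<le> \<delta>" for t
  proof -
    define p where "p = extrapolated x b k t"
    have p: "p = z + t *\<^sub>R d"
      by (simp add: p_def extrapolated_def z_def d_def)
    have p_mem: "p \<in> block_space ?s"
      unfolding p z_def d_def
      by (intro subspace_add[OF subspace_block_space] subspace_scale[OF subspace_block_space]
          subspace_diff[OF subspace_block_space]) auto
    let ?Q = "\<lambda>y. G p \<bullet> y + Lk * (norm (y - p))\<^sup>2 + \<phi> y"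
    have Q: "subproblem f g h' lam ?s ?X p (\<alpha> k) = ?Q"
      unfolding subproblem_def coeff G_def \<phi>_def ..
    define y where "y = arg_min ?Q (\<lambda>y. y \<in> block_space ?s)"
    have "\<exists>y. is_arg_min ?Q (\<lambda>y. y \<in> block_space ?s) y"
      using p_mem
      by (intro prox_subproblem_has_minimizer closed_subspace[OF subspace_block_space]
          Lk cont_\<phi> \<phi>_nonneg) auto
    then have "is_arg_min ?Q (\<lambda>y. y \<in> block_space ?s) y"
      unfolding y_def arg_min_def by (rule someI_ex)
    then have y: "y \<in> block_space ?s" "?Q y \<le> ?Q e"
      using e by (auto simp: is_arg_min_linorder)
    have "norm (G p - G z) \<le> Lk * norm (p - z)"
      using lipschitz_onD[OF lip p_mem, of z] by (simp add: G_def dist_norm z_def)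
    from extrapolated_minimizer_bound[OF less_imp_le[OF Lk] this y(2)]
    have "G z \<bullet> (y - z) + Lk / 2 * (norm (y - z))\<^sup>2 + \<phi> y
        \<le> \<phi> z - \<delta> + (3 * Lk * norm (p - z) * norm (e - z) + 9 / 2 * Lk * (norm (p - z))\<^sup>2)"
      by (simp add: \<delta>_def)
    also have "3 * Lk * norm (p - z) * norm (e - z) + 9 / 2 * Lk * (norm (p - z))\<^sup>2 \<le> t * C"
    proof -
      \<comment> \<open>\<open>t \<le> 1\<close> turns the quadratic error into a linear one\<close>
      have "t\<^sup>2 * (9 / 2 * Lk * (norm d)\<^sup>2) \<le> t * (9 / 2 * Lk * (norm d)\<^sup>2)"
        using t Lk by (intro mult_right_mono) (auto simp: power2_eq_square mult_left_le)
      then show ?thesis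
        using t(1) by (simp add: p C_def power_mult_distrib algebra_simps)
    qed
    finally have "G z \<bullet> (y - z) + Lk / 2 * (norm (y - z))\<^sup>2 + \<phi> y \<le> \<phi> z"
      using t(3) by linarith
    moreover have "bpiree_iterate f g h' lam x b k (\<alpha> k) t = block_replace ?s ?X y"
      unfolding bpiree_iterate_def y_def p_def[symmetric] Q ..
    ultimately show ?thesis
      using objective_block_majorant[where g = g and h = h and h' = h',
          OF assms(1) less_imp_le[OF assms(2)] diff lip conc deriv y(1)]
      unfolding zG unfolding \<phi>_def z_def by simp
  qed
  \<comment> \<open>The denominator is \<open>C + 1\<close> because \<open>C\<close> vanishes when the block has not moved (\<open>d = 0\<close>).\<close>
  show ?thesis
  proof (intro exI[of _ "min 1 (\<delta> / (C + 1))"] conjI ballI)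
    show "0 < min 1 (\<delta> / (C + 1))" using \<delta> C by simp
  next
    fix t assume t: "t \<in> {0..min 1 (\<delta> / (C + 1))}"
    then have "t * (C + 1) \<le> \<delta>" using C by (simp add: pos_le_divide_eq)
    then have "t * C \<le> \<delta>" using t by (auto simp: algebra_simps)
    then show "objective f g h lam P (bpiree_iterate f g h' lam x b k (\<alpha> k) t)
        \<le> objective f g h lam P ?X"
      using t by (intro decrease) auto
  qed
qed

end
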